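(* Let $p$ be a prime number. Then the set of cyclic $p$-roots is finite; that is, the set of $z=(z_0,\ldots,z_{p-1})\in\mathbb{C}^p$ satisfying $$\sum_{i=0}^{p-1} z_iz_{i+1}\cdots z_{i+j-1}=0\quad (1\le j\le p-1),\qquad z_0z_1\cdots z_{p-1}=1$$ (indices modulo $p$) is finite.
   Context: For $n\ge 2$, the cyclic $n$-roots are the solutions $z=(z_0,\ldots,z_{n-1})\in\mathbb{C}^n$ of the $n$ equations: $z_0+z_1+\cdots+z_{n-1}=0$; $z_0z_1+z_1z_2+\cdots+z_{n-1}z_0=0$; $\ldots$; $z_0z_1\cdots z_{n-2}+\cdots+z_{n-1}z_0\cdots z_{n-3}=0$; $z_0z_1\cdots z_{n-1}=1$. The $j$-th equation ($1\le j\le n-1$) is $\sum_{i=0}^{n-1} z_iz_{i+1}\cdots z_{i+j-1}=0$ with indices modulo $n$. *)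

theory Defs
  imports Complex_Main "HOL-Library.FuncSet" "HOL-Computational_Algebra.Primes"
begin

text \<open>
  A point of \<open>\<complex>\<^sup>n\<close> is an extensional function on \<open>{..<n}\<close> (undefined outside), so
  that distinct elements of the set are distinct points of \<open>\<complex>\<^sup>n\<close>.
\<close>

definition cyclic_roots :: "nat \<Rightarrow> (nat \<Rightarrow> complex) set" where
  "cyclic_roots n =
     {z \<in> {..<n} \<rightarrow>\<^sub>E UNIV.
        (\<forall>j\<in>{1..n - 1}. (\<Sum>i<n. \<Prod>k<j. z ((i + k) mod n)) = 0) \<and>
        (\<Prod>i<n. z i) = 1}"

end

theory Submission
  imports Defs "HOL-Analysis.Analysis"
    "HOL-Computational_Algebra.Fundamental_Theorem_Algebra"
    "HOL-Library.Function_Algebras"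
begin

text \<open>
  The set of cyclic \<open>p\<close>-roots is an algebraic set.  It is shown to be bounded, and a bounded
  algebraic set is finite.

  For boundedness, write a cyclic root as \<open>z\<^sub>k = x\<^sub>k\<^sub>+\<^sub>1 / x\<^sub>k\<close> with
  \<open>x\<^sub>k = z\<^sub>0 \<dots> z\<^sub>k\<^sub>-\<^sub>1\<close>, and put \<open>y = 1/x\<close>.  The equations say that
  the cyclic correlation of \<open>x\<close> and \<open>y\<close> is \<open>p\<close> times the unit impulse, so the
  Fourier transforms of \<open>x\<close> and \<open>y\<close>, the latter at the conjugate root of unity, have
  pointwise product \<open>p\<close>; the pointwise product of \<open>x\<close> and \<open>y\<close> is \<open>1\<close> by
  construction.  If \<open>\<parallel>x\<parallel> \<parallel>y\<parallel>\<close> were unbounded, rescaling to norm \<open>1\<close> and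
  passing to a limit would give nonzero vectors with disjoint supports whose transforms also have disjoint
  supports (in the text, \<open>overlap_lower_bound\<close> expresses this by the minimum of a continuous
  function on a compact set).  For prime \<open>p\<close> this contradicts the uncertainty principle
  \<open>uncertainty_principle_prime\<close>: the supports of a nonzero vector and of its transform have
  more than \<open>p\<close> elements together.

  The uncertainty principle is Chebotarev's theorem on the minors of the Fourier matrix
  (\<open>sparse_poly_few_roots\<close>).  The idea is to reduce modulo \<open>1 - w\<close>, where all
  \<open>p\<close>-th roots of unity coincide with \<open>1\<close> and the characteristic is \<open>p\<close>: a polynomial of
  degree below \<open>p\<close> with \<open>k\<close> terms cannot vanish there to order \<open>k\<close>.  The
  coefficients are arbitrary complex numbers, so the reduction takes place in the
  \<open>\<int>[w]\<close>-module that they generate; it is nontrivial because this module is finitely generated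
  (\<open>cyclo_span_not_divisible\<close>).

  A bounded algebraic set is finite (\<open>bounded_coordinate_imp_finite\<close>), because each of its
  coordinate functions omits uncountably many values \<open>l\<close>.  By the weak Nullstellensatz each
  \<open>1 / (z\<^sub>i - l)\<close> is a polynomial function on the set; the polynomial functions have only countable
  dimension, so these inverses are linearly dependent, and clearing denominators in the relation gives a nonzero
  polynomial satisfied by \<open>z\<^sub>i\<close>.  The Nullstellensatz itself follows from the same dimension
  count.
\<close>

section \<open>Bounded algebraic sets\<close>

text \<open>
  Functions of countably many variables are no harder to treat than functions of finitely many: only
  the countability of the set of monomials matters below.
\<close>

inductive_set polyfuns :: "((nat \<Rightarrow> complex) \<Rightarrow> complex) set" where
  const: "(\<lambda>z. c) \<in> polyfuns"
| var: "(\<lambda>z. z i) \<in> polyfuns"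
| add: "f \<in> polyfuns \<Longrightarrow> g \<in> polyfuns \<Longrightarrow> (\<lambda>z. f z + g z) \<in> polyfuns"
| mult: "f \<in> polyfuns \<Longrightarrow> g \<in> polyfuns \<Longrightarrow> (\<lambda>z. f z * g z) \<in> polyfuns"

lemma polyfuns_diff:
  assumes "f \<in> polyfuns" "g \<in> polyfuns" shows "(\<lambda>z. f z - g z) \<in> polyfuns"
  using polyfuns.add[OF assms(1) polyfuns.mult[OF polyfuns.const[of "-1"] assms(2)]] by simp

lemma polyfuns_sum:
  "(\<And>a. a \<in> S \<Longrightarrow> f a \<in> polyfuns) \<Longrightarrow> (\<lambda>z. \<Sum>a\<in>S. f a z) \<in> polyfuns"
  by (induction S rule: infinite_finite_induct)
     (auto intro: polyfuns.const polyfuns.add)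

lemma polyfuns_prod:
  "(\<And>a. a \<in> S \<Longrightarrow> f a \<in> polyfuns) \<Longrightarrow> (\<lambda>z. \<Prod>a\<in>S. f a z) \<in> polyfuns"
  by (induction S rule: infinite_finite_induct)
     (auto intro: polyfuns.const polyfuns.mult)

lemma polyfuns_power: "f \<in> polyfuns \<Longrightarrow> (\<lambda>z. f z ^ n) \<in> polyfuns"
  using polyfuns_prod[of "{..<n}" "\<lambda>_. f"] by simp

interpretation cfun: vector_space "\<lambda>(c::complex) (f :: 'a \<Rightarrow> complex) x. c * f x"
  by unfold_locales (auto simp: fun_eq_iff algebra_simps)

lemma sum_fun_apply: "(\<Sum>a\<in>S. f a) z = (\<Sum>a\<in>S. f a z)"
  by (induction S rule: infinite_finite_induct) auto

definition monomial :: "nat list \<Rightarrow> (nat \<Rightarrow> complex) \<Rightarrow> complex" where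
  "monomial l = (\<lambda>z. \<Prod>i\<leftarrow>l. z i)"

lemma monomial_mult_span:
  assumes "f \<in> cfun.span (range monomial)"
  shows "(\<lambda>z. monomial l z * f z) \<in> cfun.span (range monomial)"
  using assms
proof (induction rule: cfun.span_induct_alt)
  case base
  then show ?case using cfun.span_zero by (simp add: zero_fun_def)
next
  case (step c x y)
  then obtain m where m: "x = monomial m" by auto
  have "(\<lambda>z. monomial l z * ((\<lambda>z. c * x z) + y) z)
      = (\<lambda>z. c * monomial (l @ m) z) + (\<lambda>z. monomial l z * y z)"
    by (simp add: m monomial_def fun_eq_iff algebra_simps)
  moreover have "\<dots> \<in> cfun.span (range monomial)"
    by (intro cfun.span_add cfun.span_scale step.IH) (auto intro: cfun.span_base)
  ultimately show ?case by (simp only:)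
qed

lemma polyfuns_subset_span: "f \<in> polyfuns \<Longrightarrow> f \<in> cfun.span (range monomial)"
proof (induction rule: polyfuns.induct)
  case (const c)
  have "(\<lambda>z. c * monomial [] z) \<in> cfun.span (range monomial)"
    by (intro cfun.span_scale cfun.span_base) auto
  then show ?case by (simp add: monomial_def)
next
  case (var i)
  have "monomial [i] \<in> cfun.span (range monomial)"
    by (intro cfun.span_base) auto
  then show ?case by (simp add: monomial_def)
next
  case (add f g)
  then show ?case using cfun.span_add[of f _ g] by (simp add: plus_fun_def)
next
  case (mult f g)
  show ?case using mult.IH(1)
  proof (induction rule: cfun.span_induct_alt)
    case base
    then show ?case using cfun.span_zero by (simp add: zero_fun_def)
  next
    case (step c x y)
    then obtain m where m: "x = monomial m" by auto
    have "(\<lambda>z. ((\<lambda>z. c * x z) + y) z * g z)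
      = (\<lambda>z. c * (monomial m z * g z)) + (\<lambda>z. y z * g z)"
      by (simp add: m fun_eq_iff algebra_simps)
    moreover have "\<dots> \<in> cfun.span (range monomial)"
      using step.IH monomial_mult_span[OF mult.IH(2)]
      by (intro cfun.span_add cfun.span_scale) auto
    ultimately show ?case by (simp only:)
  qed
qed

text \<open>
  Polynomial functions form a space of countable dimension: it is the union of the spans of the first
  \<open>N\<close> monomials.  An uncountable family therefore has infinitely many members in one of these
  spans, and \<open>N + 1\<close> of them are linearly dependent.
\<close>

lemma uncountable_family_dependent:
  fixes q :: "complex \<Rightarrow> (nat \<Rightarrow> complex) \<Rightarrow> complex"
  assumes S: "uncountable S" and q: "\<And>l. l \<in> S \<Longrightarrow> q l \<in> polyfuns"
  obtains T c where "finite T" "T \<subseteq> S" "\<exists>l\<in>T. c l \<noteq> 0" "\<And>z. (\<Sum>l\<in>T. c l * q l z) = (0::complex)"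
proof -
  define B where "B N = monomial ` {l. to_nat l < N}" for N
  have finB: "finite (B N)" and cardB: "card (B N) \<le> N" for N
  proof -
    have f: "finite {l::nat list. to_nat l < N}" 
      by (rule finite_imageD[of to_nat]) (auto intro: finite_subset[of _ "{..<N}"])
    have "card {l::nat list. to_nat l < N} \<le> card {..<N}"
      by (rule card_inj_on_le[of to_nat]) auto
    with f show "finite (B N)" "card (B N) \<le> N"
      unfolding B_def by (auto intro: order.trans[OF card_image_le])
  qed
  have ex: "\<exists>N. f \<in> cfun.span (B N)" if "f \<in> polyfuns" for f
  proof -
    from polyfuns_subset_span[OF that] show ?thesis
    proof (induction rule: cfun.span_induct_alt)
      case base
      then show ?case using cfun.span_zero by (auto simp: zero_fun_def)
    next
      case (step c x y)
      then obtain m N where m: "x = monomial m" and N: "y \<in> cfun.span (B N)" by auto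
      let ?N = "max N (Suc (to_nat m))"
      have "x \<in> cfun.span (B ?N)"
        unfolding m B_def by (intro cfun.span_base) auto
      moreover have "y \<in> cfun.span (B ?N)"
        by (rule subsetD[OF cfun.span_mono N]) (auto simp: B_def)
      ultimately have "(\<lambda>z. c * x z) + y \<in> cfun.span (B ?N)"
        by (intro cfun.span_add cfun.span_scale)
      then show ?case by blast
    qed
  qed
  have "S = (\<Union>N. {l\<in>S. q l \<in> cfun.span (B N)})" using ex q by auto
  then have "\<exists>N. uncountable {l\<in>S. q l \<in> cfun.span (B N)}"
    using S countable_UN[of "UNIV :: nat set" "\<lambda>N. {l\<in>S. q l \<in> cfun.span (B N)}"] by auto
  then obtain N where "uncountable {l\<in>S. q l \<in> cfun.span (B N)}" ..
  then have "infinite {l\<in>S. q l \<in> cfun.span (B N)}"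
    using countable_finite by blast
  then obtain T where T: "T \<subseteq> {l\<in>S. q l \<in> cfun.span (B N)}" "card T = Suc N" "finite T"
    using infinite_arbitrarily_large by blast
  show thesis
  proof (cases "inj_on q T")
    case False
    \<comment> \<open>The relation is indexed by \<open>l\<close>, so two indices with the same function already give one.\<close>
    then obtain l m where lm: "l \<in> T" "m \<in> T" "l \<noteq> m" "q l = q m" by (auto simp: inj_on_def)
    show thesis
    proof (rule that[of "{l, m}" "\<lambda>a. if a = l then 1 else -1"])
    qed (use lm T in auto)
  next
    case True
    have "cfun.dependent (q ` T)"
    proof (rule ccontr)
      assume "\<not> cfun.dependent (q ` T)"
      then have "card (q ` T) \<le> card (B N)"
        using cfun.independent_span_bound[OF finB, of "q ` T" N] T by auto
      then show False using card_image[OF True] T cardB[of N] by simp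
    qed
    then obtain u where u: "\<exists>v\<in>q ` T. u v \<noteq> 0" "(\<Sum>v\<in>q ` T. (\<lambda>x. u v * v x)) = 0"
      using cfun.dependent_finite[of "q ` T"] T by auto
    have z: "(\<Sum>l\<in>T. u (q l) * q l z) = 0" for z
    proof -
      have "(\<Sum>l\<in>T. u (q l) * q l z) = (\<Sum>v\<in>q ` T. u v * v z)"
        by (simp add: sum.reindex[OF True])
      also have "\<dots> = (\<Sum>v\<in>q ` T. (\<lambda>x. u v * v x)) z"
        by (rule sum_fun_apply[symmetric])
      finally show ?thesis using u(2) by simp
    qed
    show thesis by (rule that[of T "\<lambda>l. u (q l)"]) (use u z T in auto)
  qed
qed

definition poly_ideal :: "((nat \<Rightarrow> complex) \<Rightarrow> complex) set \<Rightarrow> bool" where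
  "poly_ideal I \<longleftrightarrow> I \<subseteq> polyfuns \<and> (\<lambda>z. 0) \<in> I \<and>
     (\<forall>f\<in>I. \<forall>g\<in>I. (\<lambda>z. f z + g z) \<in> I) \<and>
     (\<forall>f\<in>polyfuns. \<forall>g\<in>I. (\<lambda>z. f z * g z) \<in> I)"

lemma poly_idealD:
  assumes "poly_ideal I"
  shows "f \<in> I \<Longrightarrow> f \<in> polyfuns" "(\<lambda>z. 0) \<in> I"
    "f \<in> I \<Longrightarrow> g \<in> I \<Longrightarrow> (\<lambda>z. f z + g z) \<in> I"
    "f \<in> polyfuns \<Longrightarrow> g \<in> I \<Longrightarrow> (\<lambda>z. f z * g z) \<in> I"
  using assms unfolding poly_ideal_def by auto

lemma poly_ideal_diff:
  assumes I: "poly_ideal I" "f \<in> I" "g \<in> I"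
  shows "(\<lambda>z. f z - g z) \<in> I"
  using poly_idealD(3)[OF I(1) I(2) poly_idealD(4)[OF I(1) polyfuns.const[of "-1"] I(3)]] by simp

lemma poly_ideal_sum:
  assumes "poly_ideal I" "\<And>a. a \<in> S \<Longrightarrow> f a \<in> I"
  shows "(\<lambda>z. \<Sum>a\<in>S. f a z) \<in> I"
  using assms(2)
  by (induction S rule: infinite_finite_induct) (auto intro: poly_idealD[OF assms(1)])

text \<open>
  The coordinate \<open>z i\<close> is algebraic modulo \<open>I\<close> as soon as \<open>z i - l\<close> has an
  inverse \<open>q l\<close> modulo \<open>I\<close> for uncountably many \<open>l\<close>.  A linear relation
  \<open>\<Sum>l\<in>T. c l * q l = 0\<close> exists by countability of the dimension; it reads
  \<open>\<Sum>l\<in>T. c l / (z i - l) = 0\<close> modulo \<open>I\<close>, and clearing denominators gives the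
  polynomial.
\<close>

lemma invertible_translates_imp_algebraic:
  assumes I: "poly_ideal I" and S: "uncountable S"
    and inv: "\<And>l. l \<in> S \<Longrightarrow> \<exists>q\<in>polyfuns. (\<lambda>z. q z * (z i - l) - 1) \<in> I"
  obtains P :: "complex poly" where "P \<noteq> 0" "(\<lambda>z. poly P (z i)) \<in> I"
proof -
  have "\<forall>l\<in>S. \<exists>q. q \<in> polyfuns \<and> (\<lambda>z. q z * (z i - l) - 1) \<in> I"
    using inv by blast
  from bchoice[OF this] obtain q where q: "\<And>l. l \<in> S \<Longrightarrow> q l \<in> polyfuns"
      "\<And>l. l \<in> S \<Longrightarrow> (\<lambda>z. q l z * (z i - l) - 1) \<in> I"
    by auto
  obtain T c where T: "finite T" "T \<subseteq> S" "\<exists>l\<in>T. c l \<noteq> 0" "\<And>z. (\<Sum>l\<in>T. c l * q l z) = 0"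
    using uncountable_family_dependent[of S q] S q(1) by blast
  define P where "P = (\<Sum>l\<in>T. smult (c l) (\<Prod>m\<in>T-{l}. [:-m, 1:]))"
  have P: "poly P x = (\<Sum>l\<in>T. c l * (\<Prod>m\<in>T-{l}. x - m))" for x
    by (simp add: P_def poly_sum poly_prod)
  have "P \<noteq> 0"
  proof
    assume "P = 0"
    \<comment> \<open>At a node with a nonzero coefficient only one summand of \<open>P\<close> survives.\<close>
    obtain l where l: "l \<in> T" "c l \<noteq> 0" using T by blast
    have "poly P l = (\<Sum>k\<in>{l}. c k * (\<Prod>m\<in>T-{k}. l - m))"
      unfolding P by (rule sum.mono_neutral_right) (use T l in auto)
    also have "\<dots> \<noteq> 0" using l T by simp
    finally show False using \<open>P = 0\<close> by simp
  qed
  moreover have "(\<lambda>z. poly P (z i)) \<in> I"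
  proof -
    have "(\<lambda>z. \<Sum>l\<in>T. (- c l * (\<Prod>m\<in>T-{l}. z i - m)) * (q l z * (z i - l) - 1)) \<in> I"
    proof (rule poly_ideal_sum[OF I], rule poly_idealD(4)[OF I])
      fix l assume "l \<in> T"
      with T(2) q(2) show "(\<lambda>z. q l z * (z i - l) - 1) \<in> I" by auto
    qed (intro polyfuns.mult polyfuns_prod polyfuns_diff polyfuns.const polyfuns.var)
    moreover have "(\<Sum>l\<in>T. (- c l * (\<Prod>m\<in>T-{l}. z i - m)) * (q l z * (z i - l) - 1)) = poly P (z i)" 
      for z :: "nat \<Rightarrow> complex"
    proof -
      have "(- c l * (\<Prod>m\<in>T-{l}. z i - m)) * (q l z * (z i - l) - 1)
          = c l * (\<Prod>m\<in>T-{l}. z i - m) - (\<Prod>m\<in>T. z i - m) * (c l * q l z)" if "l \<in> T" for l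
        using that T(1) by (simp add: prod.remove[of T l] algebra_simps)
      then have "(\<Sum>l\<in>T. (- c l * (\<Prod>m\<in>T-{l}. z i - m)) * (q l z * (z i - l) - 1))
         = poly P (z i) - (\<Prod>m\<in>T. z i - m) * (\<Sum>l\<in>T. c l * q l z)"
        by (simp add: P sum_subtractf sum_distrib_left)
      then show ?thesis using T(4) by simp
    qed
    ultimately show ?thesis by simp
  qed
  ultimately show thesis by (rule that)
qed

lemma poly_ideal_adjoin:
  assumes I: "poly_ideal I" and f: "f \<in> polyfuns"
  shows "poly_ideal {(\<lambda>z. g z + q z * f z) | g q. g \<in> I \<and> q \<in> polyfuns}" (is "poly_ideal ?J")
    and "I \<subseteq> {(\<lambda>z. g z + q z * f z) | g q. g \<in> I \<and> q \<in> polyfuns}"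
    and "f \<in> {(\<lambda>z. g z + q z * f z) | g q. g \<in> I \<and> q \<in> polyfuns}"
proof -
  have mem: "h \<in> ?J" if "g \<in> I" "q \<in> polyfuns" "h = (\<lambda>z. g z + q z * f z)" for h g q
    using that by blast
  show "I \<subseteq> ?J"
    using mem[OF _ polyfuns.const[of 0]] by auto
  show "f \<in> ?J"
    by (rule mem[OF poly_idealD(2)[OF I] polyfuns.const[of 1]]) simp
  show "poly_ideal ?J"
    unfolding poly_ideal_def
  proof (intro conjI ballI)
    show "?J \<subseteq> polyfuns" using f poly_idealD(1)[OF I] by (auto intro: polyfuns.intros)
    show "(\<lambda>z. 0) \<in> ?J"
      by (rule mem[OF poly_idealD(2)[OF I] polyfuns.const[of 0]]) simp
  next
    fix u v assume "u \<in> ?J" "v \<in> ?J"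
    then obtain g q g' q' where *: "g \<in> I" "q \<in> polyfuns" "u = (\<lambda>z. g z + q z * f z)"
      "g' \<in> I" "q' \<in> polyfuns" "v = (\<lambda>z. g' z + q' z * f z)" by auto
    show "(\<lambda>z. u z + v z) \<in> ?J"
      by (rule mem[OF poly_idealD(3)[OF I *(1,4)] polyfuns.add[OF *(2,5)]])
         (simp add: * algebra_simps)
  next
    fix u v assume "u \<in> polyfuns" "v \<in> ?J"
    then obtain g q where *: "g \<in> I" "q \<in> polyfuns" "v = (\<lambda>z. g z + q z * f z)" by auto
    show "(\<lambda>z. u z * v z) \<in> ?J"
      by (rule mem[OF poly_idealD(4)[OF I \<open>u \<in> polyfuns\<close> *(1)] polyfuns.mult[OF \<open>u \<in> polyfuns\<close> *(2)]])
         (simp add: * algebra_simps)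
  qed
qed

text \<open>
  In a maximal ideal \<open>M\<close> containing \<open>I\<close>, every coordinate is congruent to a constant.
  Otherwise all translates \<open>z i - l\<close> would be invertible modulo \<open>M\<close>, so \<open>z i\<close> would
  be algebraic modulo \<open>M\<close>; a nonzero polynomial in \<open>z i\<close> splits into linear factors, and one
  of them lies in \<open>M\<close> because \<open>M\<close> is prime.  The constants are the coordinates of a
  common zero.
\<close>

lemma weak_nullstellensatz:
  assumes I: "poly_ideal I" and proper: "(\<lambda>z. 1) \<notin> I"
  obtains a where "\<And>f. f \<in> I \<Longrightarrow> f a = 0"
proof -
  define PI where "PI = {J. poly_ideal J \<and> (\<lambda>z. 1) \<notin> J \<and> I \<subseteq> J}"
  have "\<exists>M\<in>PI. \<forall>X\<in>PI. M \<subseteq> X \<longrightarrow> X = M"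
  proof (rule subset_Zorn_nonempty)
    show "PI \<noteq> {}" using assms by (auto simp: PI_def)
  next
    fix C assume C: "C \<noteq> {}" "subset.chain PI C"
    then have CP: "\<And>J. J \<in> C \<Longrightarrow> poly_ideal J \<and> (\<lambda>z. 1) \<notin> J \<and> I \<subseteq> J"
      by (auto simp: PI_def subset.chain_def)
    have "poly_ideal (\<Union>C)"
      unfolding poly_ideal_def
    proof (intro conjI ballI)
      show "\<Union>C \<subseteq> polyfuns" using CP poly_idealD(1) by blast
      show "(\<lambda>z. 0) \<in> \<Union>C" using CP C(1) poly_idealD(2) by blast
    next
      fix f g assume "f \<in> \<Union>C" "g \<in> \<Union>C"
      then obtain J K where "J \<in> C" "K \<in> C" "f \<in> J" "g \<in> K" by auto
      moreover have "J \<subseteq> K \<or> K \<subseteq> J"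
        using C(2) \<open>J \<in> C\<close> \<open>K \<in> C\<close> by (auto simp: subset_chain_def)
      ultimately show "(\<lambda>z. f z + g z) \<in> \<Union>C"
        using CP poly_idealD(3) by (metis UnionI subsetD)
    next
      fix f g assume "f \<in> polyfuns" "g \<in> \<Union>C"
      then show "(\<lambda>z. f z * g z) \<in> \<Union>C"
        using CP poly_idealD(4) by (metis UnionE UnionI)
    qed
    then show "\<Union>C \<in> PI" using CP C(1) by (auto simp: PI_def)
  qed
  then obtain M where "M \<in> PI" and max: "\<And>X. X \<in> PI \<Longrightarrow> M \<subseteq> X \<Longrightarrow> X = M" by blast
  then have M: "poly_ideal M" "(\<lambda>z. 1) \<notin> M" "I \<subseteq> M" by (auto simp: PI_def)
  have inverse: "\<exists>q\<in>polyfuns. (\<lambda>z. q z * f z - 1) \<in> M" if f: "f \<in> polyfuns" "f \<notin> M" for f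
  proof -
    let ?J = "{(\<lambda>z. g z + q z * f z) | g q. g \<in> M \<and> q \<in> polyfuns}"
    have "(\<lambda>z. 1) \<in> ?J"
    proof (rule ccontr)
      assume "(\<lambda>z. 1) \<notin> ?J"
      then have "?J \<in> PI"
        using poly_ideal_adjoin[OF M(1) f(1)] M(3) unfolding PI_def by blast
      then show False using max[OF _ poly_ideal_adjoin(2)[OF M(1) f(1)]]
        using poly_ideal_adjoin(3)[OF M(1) f(1)] f(2) by blast
    qed
    then obtain g q where gq: "g \<in> M" "q \<in> polyfuns" "(\<lambda>z. 1) = (\<lambda>z. g z + q z * f z)" by auto
    have "(\<lambda>z. (-1) * g z) \<in> M" by (rule poly_idealD(4)[OF M(1) polyfuns.const gq(1)])
    moreover have "(\<lambda>z. (-1) * g z) = (\<lambda>z. q z * f z - 1)"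
      using gq(3) by (auto simp: fun_eq_iff algebra_simps)
    ultimately show ?thesis using gq(2) by auto
  qed
  have prime: "g \<in> M" if fg: "(\<lambda>z. f z * g z) \<in> M" "f \<in> polyfuns" "g \<in> polyfuns" "f \<notin> M" for f g
  proof -
    obtain q where q: "q \<in> polyfuns" "(\<lambda>z. q z * f z - 1) \<in> M"
      using inverse fg by blast
    have "(\<lambda>z. q z * (f z * g z) - g z * (q z * f z - 1)) \<in> M"
      by (intro poly_ideal_diff[OF M(1)] poly_idealD(4)[OF M(1)] q fg)
    then show ?thesis by (simp add: algebra_simps)
  qed
  have root: "\<exists>l. (\<lambda>z. z i - l) \<in> M" if "P \<noteq> 0" "(\<lambda>z. poly P (z i)) \<in> M" for P i
    using that
  proof (induction "degree P" arbitrary: P rule: less_induct)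
    case less
    show ?case
    proof (cases "degree P = 0")
      case True
      then obtain c where c: "P = [:c:]" by (auto elim: degree_eq_zeroE)
      then have "(\<lambda>z. (1/c) * c) \<in> M"
        using less.prems poly_idealD(4)[OF M(1) polyfuns.const[of "1/c"]] by fastforce
      then show ?thesis using c less.prems M(2) by simp
    next
      case False
      then obtain r where "poly P r = 0"
        using fundamental_theorem_of_algebra_alt[of P] by (metis degree_pCons_0 )
      then obtain Q where Q: "P = [:-r, 1:] * Q" by (metis dvdE poly_eq_0_iff_dvd)
      with less.prems have "Q \<noteq> 0" by auto
      then have deg: "degree Q < degree P" unfolding Q by (subst degree_mult_eq) auto
      have pf: "(\<lambda>z. poly Q (z i)) \<in> polyfuns"
        unfolding poly_altdef
        by (intro polyfuns_sum polyfuns.mult polyfuns.const polyfuns_power polyfuns.var)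
      show ?thesis
      proof (cases "(\<lambda>z. z i - r) \<in> M")
        case F: False
        have "(\<lambda>z. (z i - r) * poly Q (z i)) \<in> M"
          using less.prems(2) by (simp add: Q algebra_simps)
        then have "(\<lambda>z. poly Q (z i)) \<in> M"
          by (rule prime[OF _ _ pf F]) (intro polyfuns_diff polyfuns.intros)
        then show ?thesis using less.hyps[OF deg \<open>Q \<noteq> 0\<close>] by blast
      qed blast
    qed
  qed
  have "\<exists>l. (\<lambda>z. z i - l) \<in> M" for i
  proof (rule ccontr)
    assume neg: "\<nexists>l. (\<lambda>z. z i - l) \<in> M"
    have "uncountable (ball (0::complex) 1)" by (rule uncountable_ball) auto
    moreover have "\<exists>q\<in>polyfuns. (\<lambda>z. q z * (z i - l) - 1) \<in> M" for l
      using neg by (intro inverse polyfuns_diff polyfuns.intros) auto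
    ultimately obtain P where "P \<noteq> 0" "(\<lambda>z. poly P (z i)) \<in> M"
      by (rule invertible_translates_imp_algebraic[OF M(1)])
    then show False using root neg by blast
  qed
  then obtain a where a: "\<And>i. (\<lambda>z. z i - a i) \<in> M" by metis
  have eval: "(\<lambda>z. f z - f a) \<in> M" if "f \<in> polyfuns" for f
    using that
  proof (induction rule: polyfuns.induct)
    case (const c)
    then show ?case using poly_idealD(2)[OF M(1)] by simp
  next
    case (var i)
    then show ?case by (rule a)
  next
    case (add f g)
    then show ?case using poly_idealD(3)[OF M(1) add.IH] by (simp add: algebra_simps)
  next
    case (mult f g)
    have "(\<lambda>z. g z * (f z - f a) + f a * (g z - g a)) \<in> M"
      by (intro poly_idealD(3,4)[OF M(1)] mult polyfuns.const)
    then show ?case by (simp add: algebra_simps)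
  qed
  show thesis
  proof (rule that)
    fix f assume f: "f \<in> I"
    have "(\<lambda>z. f z - (f z - f a)) \<in> M"
      by (rule poly_ideal_diff[OF M(1) subsetD[OF M(3) f] eval[OF poly_idealD(1)[OF I f]]])
    from poly_idealD(4)[OF M(1) polyfuns.const[of "1 / f a"] this]
    show "f a = 0" using M(2) by (cases "f a = 0") simp_all
  qed
qed

text \<open>
  For \<open>\<bar>l\<bar> > R\<close> the function \<open>z i - l\<close> has no zero on \<open>V\<close>, so the
  Nullstellensatz inverts it modulo the ideal of \<open>V\<close>.  These are uncountably many \<open>l\<close>, so a
  nonzero polynomial in \<open>z i\<close> vanishes on \<open>V\<close>.
\<close>

lemma bounded_coordinate_imp_finite:
  assumes F: "F \<subseteq> polyfuns" and V: "V = {z. \<forall>f\<in>F. f z = 0}"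
    and bd: "\<And>z. z \<in> V \<Longrightarrow> cmod (z i) \<le> R"
  shows "finite ((\<lambda>z. z i) ` V)"
proof -
  define I where "I = {f\<in>polyfuns. \<forall>z\<in>V. f z = 0}"
  have I: "poly_ideal I"
    unfolding poly_ideal_def
  proof (intro conjI ballI)
    show "I \<subseteq> polyfuns" "(\<lambda>z. 0) \<in> I"
      using polyfuns.const[of 0] by (simp_all add: I_def)
  next
    fix f g assume "f \<in> I" "g \<in> I"
    then show "(\<lambda>z. f z + g z) \<in> I"
      using polyfuns.add[of f g] by (simp add: I_def)
  next
    fix f g assume "f \<in> polyfuns" "g \<in> I"
    then show "(\<lambda>z. f z * g z) \<in> I"
      using polyfuns.mult[of f g] by (simp add: I_def)
  qed
  define S where "S = {l. cmod l > R}"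
  have "uncountable S"
  proof
    assume "countable S"
    have "ball (of_real (\<bar>R\<bar> + 1)) 1 \<subseteq> S"
    proof
      fix x :: complex assume "x \<in> ball (of_real (\<bar>R\<bar> + 1)) 1"
      then have "cmod (of_real (\<bar>R\<bar> + 1) - x) < 1" by (simp add: dist_norm)
      moreover have "cmod (of_real (\<bar>R\<bar> + 1)) \<le> cmod (of_real (\<bar>R\<bar> + 1) - x) + cmod x"
        by (metis diff_add_cancel norm_triangle_ineq)
      moreover have "cmod (of_real (\<bar>R\<bar> + 1)) = \<bar>R\<bar> + 1" unfolding norm_of_real by simp
      ultimately show "x \<in> S" by (simp add: S_def)
    qed
    with \<open>countable S\<close> show False
      using countable_subset uncountable_ball[of 1 "of_real (\<bar>R\<bar> + 1) :: complex"] by auto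
  qed
  moreover have "\<exists>q\<in>polyfuns. (\<lambda>z. q z * (z i - l) - 1) \<in> I" if "l \<in> S" for l
  proof -
    have f: "(\<lambda>z. z i - l) \<in> polyfuns" by (intro polyfuns_diff polyfuns.intros)
    let ?J = "{(\<lambda>z. g z + q z * (z i - l)) | g q. g \<in> I \<and> q \<in> polyfuns}"
    have "(\<lambda>z. 1) \<in> ?J"
    proof (rule ccontr)
      assume "(\<lambda>z. 1) \<notin> ?J"
      then obtain a where a: "\<And>h. h \<in> ?J \<Longrightarrow> h a = 0"
        using weak_nullstellensatz[OF poly_ideal_adjoin(1)[OF I f]] by blast
      have "F \<subseteq> I" using F V by (auto simp: I_def)
      then have "a \<in> V" using a poly_ideal_adjoin(2)[OF I f] V by blast
      moreover have "a i = l" using a[OF poly_ideal_adjoin(3)[OF I f]] by simp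
      ultimately show False using bd that by (force simp: S_def)
    qed
    then obtain g q where gq: "g \<in> I" "q \<in> polyfuns" "(\<lambda>z. 1) = (\<lambda>z. g z + q z * (z i - l))"
      by auto
    have "(\<lambda>z. (-1) * g z) \<in> I" by (rule poly_idealD(4)[OF I polyfuns.const gq(1)])
    moreover have "(\<lambda>z. (-1) * g z) = (\<lambda>z. q z * (z i - l) - 1)"
    proof
      fix z
      have "1 = g z + q z * (z i - l)" using gq(3) by (rule fun_cong)
      then show "(-1) * g z = q z * (z i - l) - 1" by (simp add: algebra_simps)
    qed
    ultimately show ?thesis using gq(2) by auto
  qed
  ultimately obtain P where P: "P \<noteq> 0" "(\<lambda>z. poly P (z i)) \<in> I"
    using invertible_translates_imp_algebraic[OF I] by blast
  have "(\<lambda>z. z i) ` V \<subseteq> {x. poly P x = 0}" using P(2) by (auto simp: I_def)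
  then show ?thesis using poly_roots_finite[OF P(1)] finite_subset by blast
qed


section \<open>The uncertainty principle for a prime modulus\<close>

text \<open>
  The module generated by \<open>A\<close> over the ring \<open>\<int>[w]\<close>.  The ring itself is the module
  generated by \<open>1\<close>.
\<close>

inductive_set cyclo_span :: "complex \<Rightarrow> complex set \<Rightarrow> complex set" for w A where
  zero: "0 \<in> cyclo_span w A"
| gen: "x \<in> A \<Longrightarrow> x \<in> cyclo_span w A"
| add: "x \<in> cyclo_span w A \<Longrightarrow> y \<in> cyclo_span w A \<Longrightarrow> x + y \<in> cyclo_span w A"
| uminus: "x \<in> cyclo_span w A \<Longrightarrow> - x \<in> cyclo_span w A"
| root: "x \<in> cyclo_span w A \<Longrightarrow> w * x \<in> cyclo_span w A"

lemma cyclo_span_sum: "(\<And>i. i \<in> S \<Longrightarrow> f i \<in> cyclo_span w A) \<Longrightarrow> sum f S \<in> cyclo_span w A"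
  by (induction S rule: infinite_finite_induct) (auto intro: cyclo_span.intros)

lemma cyclo_span_of_nat: "x \<in> cyclo_span w A \<Longrightarrow> of_nat n * x \<in> cyclo_span w A"
  by (induction n) (auto simp: algebra_simps intro: cyclo_span.intros)

lemma cyclo_span_of_int: "x \<in> cyclo_span w A \<Longrightarrow> of_int n * x \<in> cyclo_span w A"
  by (cases n) (auto intro: cyclo_span_of_nat cyclo_span.uminus simp flip: of_nat_Suc)

lemma cyclo_span_root_power: "x \<in> cyclo_span w A \<Longrightarrow> w ^ n * x \<in> cyclo_span w A"
  by (induction n) (auto simp: mult.assoc intro: cyclo_span.intros)

abbreviation cyclo_ring :: "complex \<Rightarrow> complex set" where
  "cyclo_ring w \<equiv> cyclo_span w {1}"

lemma cyclo_ring_of_int: "of_int n \<in> cyclo_ring w"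
  using cyclo_span_of_int[OF cyclo_span.gen[of 1 "{1}" w], of n] by simp

lemma cyclo_ring_power: "w ^ n \<in> cyclo_ring w"
  using cyclo_span_root_power[OF cyclo_span.gen[of 1 "{1}" w], of n] by simp

lemma cyclo_ring_mult:
  assumes "s \<in> cyclo_ring w" "x \<in> cyclo_span w A"
  shows "s * x \<in> cyclo_span w A"
  using assms(1)
  by (induction rule: cyclo_span.induct)
     (auto simp: distrib_right mult.assoc assms(2) intro: cyclo_span.intros)

lemma cyclo_ring_one_minus_power: "\<exists>s\<in>cyclo_ring w. 1 - w ^ k = (1 - w) * s"
  by (rule bexI[of _ "\<Sum>i<k. w ^ i"])
     (auto simp: one_diff_power_eq intro!: cyclo_span_sum cyclo_ring_power)

text \<open>
  Up to a unit, \<open>p\<close> is a power of \<open>1 - w\<close>.  The two divisibilities used later come from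
  \<open>p = \<Sum>k<p. 1 - w ^ k\<close>, as \<open>\<Sum>k<p. w ^ k = 0\<close>, and from the binomial expansion of
  \<open>(1 - w) ^ p\<close>, whose inner coefficients are divisible by \<open>p\<close>.
\<close>

lemma cyclo_ring_prime_ramifies:
  assumes p: "prime p" and w: "w ^ p = 1" "w \<noteq> 1"
  shows "\<exists>s\<in>cyclo_ring w. of_nat p = (1 - w) * s"
    and "\<exists>s\<in>cyclo_ring w. (1 - w) ^ p = of_nat p * s"
proof -
  obtain s where s: "\<And>k. s k \<in> cyclo_ring w" "\<And>k. 1 - w ^ k = (1 - w) * s k"
    using cyclo_ring_one_minus_power[of w] by metis
  have "(\<Sum>k<p. w ^ k) = 0"
    using one_diff_power_eq[of w p] w by simp
  then have "of_nat p = (\<Sum>k<p. 1 - w ^ k)" by (simp add: sum_subtractf)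
  also have "\<dots> = (1 - w) * (\<Sum>k<p. s k)" by (simp add: s(2) sum_distrib_left)
  finally show "\<exists>s\<in>cyclo_ring w. of_nat p = (1 - w) * s"
    using s(1) by (blast intro: cyclo_span_sum)
  have p0: "p > 0" using p prime_gt_0_nat by blast
  \<comment> \<open>The outer terms cancel for odd \<open>p\<close>; for \<open>p = 2\<close> they add up to \<open>2\<close>.\<close>
  have ends: "\<exists>c::int. 1 + (- w) ^ p = of_nat p * of_int c"
  proof (cases "p = 2")
    case True
    then show ?thesis using w by (intro exI[of _ 1]) simp
  next
    case False
    then have "odd p" using p primes_dvd_imp_eq two_is_prime_nat by blast
    then show ?thesis using w by (intro exI[of _ 0]) simp
  qed
  then obtain c :: int where c: "1 + (- w) ^ p = of_nat p * of_int c" by blast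
  have "(1 - w) ^ p = (\<Sum>k\<le>p. of_nat (p choose k) * (- w) ^ k)"
    using binomial_ring[of "-w" 1 p] by simp
  also have "{..p} = insert 0 (insert p {1..<p})" using p0 by auto
  also have "(\<Sum>k\<in>insert 0 (insert p {1..<p}). of_nat (p choose k) * (- w) ^ k)
      = 1 + (- w) ^ p + (\<Sum>k\<in>{1..<p}. of_nat (p choose k) * (- w) ^ k)"
    using p0 by simp
  also have "(\<Sum>k\<in>{1..<p}. of_nat (p choose k) * (- w) ^ k)
     = (\<Sum>k\<in>{1..<p}. of_nat p * (of_int ((-1) ^ k * int ((p choose k) div p)) * w ^ k))"
  proof (rule sum.cong)
    fix k assume "k \<in> {1..<p}"
    then have "p dvd (p choose k)"
      using p by (intro dvd_choose_prime) auto
    then obtain m where m: "p choose k = p * m" by blast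
    show "of_nat (p choose k) * (- w) ^ k
       = of_nat p * (of_int ((-1) ^ k * int ((p choose k) div p)) * w ^ k)"
      unfolding m using p0 by (simp add: power_minus[of w])
  qed simp
  finally have "(1 - w) ^ p = of_nat p * (of_int c + 
     (\<Sum>k\<in>{1..<p}. of_int ((-1) ^ k * int ((p choose k) div p)) * w ^ k))"
    unfolding c by (simp add: algebra_simps sum_distrib_left)
  then show "\<exists>s\<in>cyclo_ring w. (1 - w) ^ p = of_nat p * s"
    by (blast intro: cyclo_span.add cyclo_span_sum cyclo_ring_mult cyclo_ring_of_int cyclo_ring_power)
qed

text \<open>
  Rational coordinates of complex numbers serve to measure divisibility by \<open>p\<close>.
\<close>

interpretation rat_complex: vector_space "\<lambda>(q::rat) (z::complex). of_rat q * z"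
  by unfold_locales (auto simp: of_rat_add of_rat_mult algebra_simps)

lemma finite_rat_common_denominator:
  assumes "finite (Q :: rat set)"
  shows "\<exists>d::int. d > 0 \<and> (\<forall>q\<in>Q. of_int d * q \<in> \<int>)"
  using assms
proof (induction rule: finite_induct)
  case empty
  then show ?case by (auto intro: exI[of _ 1])
next
  case (insert q Q)
  then obtain d :: int where d: "d > 0" "\<forall>q\<in>Q. of_int d * q \<in> \<int>" by blast
  obtain a b where ab: "q = of_int a / of_int b" "b > 0"
    by (metis quotient_of_unique quotient_of_div quotient_of_denom_pos surj_pair)
  have "of_int (d * b) * r \<in> \<int>" if "r \<in> insert q Q" for r
  proof (cases "r = q")
    case True
    then have "of_int (d * b) * r = of_int (d * a)" using ab by simp
    then show ?thesis by (metis Ints_of_int)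
  next
    case False
    then have "of_int d * r \<in> \<int>" using that d by blast
    then have "of_int b * (of_int d * r) \<in> \<int>" by (rule Ints_mult[OF Ints_of_int])
    also have "of_int b * (of_int d * r) = of_int (d * b) * r" by simp
    finally show ?thesis .
  qed
  then show ?case using d ab by (intro exI[of _ "d * b"]) auto
qed

text \<open>
  A nonzero finitely generated module \<open>M\<close> over \<open>\<int>[w]\<close> differs from \<open>(1 - w) M\<close>.
  Equality would give \<open>M = p M\<close>, so \<open>a\<close> would be divisible in \<open>M\<close> by every power
  of \<open>p\<close>.  A \<open>\<rat>\<close>-linear map \<open>f\<close> from \<open>\<complex>\<close> to \<open>\<rat>\<close> with
  \<open>f a = 1\<close> takes values in \<open>(1/d) \<int>\<close> on \<open>M\<close> for some \<open>d\<close>, since \<open>M\<close>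
  is generated as a group by the finitely many \<open>w ^ l * x\<close> with \<open>l < p\<close> and \<open>x \<in> A\<close>.
  Then all powers of \<open>p\<close> would divide \<open>d\<close>.
\<close>

lemma cyclo_span_not_divisible:
  assumes p: "prime p" and w: "w ^ p = 1" "w \<noteq> 1" and A: "finite A" "a \<in> A" "a \<noteq> 0"
  shows "\<exists>x\<in>A. \<forall>y\<in>cyclo_span w A. x \<noteq> (1 - w) * y"
proof (rule ccontr)
  let ?M = "cyclo_span w A"
  assume "\<not> ?thesis"
  then have gens: "\<exists>y\<in>?M. x = (1 - w) * y" if "x \<in> A" for x using that by blast
  have step: "\<exists>y\<in>?M. x = (1 - w) * y" if "x \<in> ?M" for x
    using that
  proof (induction rule: cyclo_span.induct)
    case zero
    show ?case by (rule bexI[of _ 0]) (auto intro: cyclo_span.zero)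
  next
    case (gen x)
    then show ?case by (rule gens)
  next
    case (add x y)
    then obtain x' y' where "x' \<in> ?M" "x = (1 - w) * x'" "y' \<in> ?M" "y = (1 - w) * y'" by blast
    then show ?case by (intro bexI[of _ "x' + y'"]) (auto simp: distrib_left intro: cyclo_span.intros)
  next
    case (uminus x)
    then obtain x' where "x' \<in> ?M" "x = (1 - w) * x'" by blast
    then show ?case by (intro bexI[of _ "- x'"]) (auto simp: algebra_simps intro: cyclo_span.intros)
  next
    case (root x)
    then obtain x' where "x' \<in> ?M" "x = (1 - w) * x'" by blast
    then show ?case by (intro bexI[of _ "w * x'"]) (auto simp: mult.left_commute[of w] intro: cyclo_span.intros)
  qed
  have step_power: "\<exists>y\<in>?M. x = (1 - w) ^ k * y" if "x \<in> ?M" for x k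
  proof (induction k)
    case 0
    then show ?case using that by simp
  next
    case (Suc k)
    then obtain y where y: "y \<in> ?M" "x = (1 - w) ^ k * y" by blast
    then obtain y' where "y' \<in> ?M" "y = (1 - w) * y'" using step by blast
    with y show ?case by (intro bexI[of _ y']) (auto simp: algebra_simps)
  qed
  obtain s where s: "s \<in> cyclo_ring w" "(1 - w) ^ p = of_nat p * s"
    using cyclo_ring_prime_ramifies(2)[OF p w] by blast
  have div_p: "\<exists>y\<in>?M. x = of_nat p ^ k * y" if "x \<in> ?M" for x k
  proof (induction k)
    case 0
    then show ?case using that by simp
  next
    case (Suc k)
    then obtain y where y: "y \<in> ?M" "x = of_nat p ^ k * y" by blast
    then obtain y' where "y' \<in> ?M" "y = (1 - w) ^ p * y'" using step_power by blast
    with y s show ?case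
      by (intro bexI[of _ "s * y'"]) (auto simp: algebra_simps intro: cyclo_ring_mult)
  qed
  define B where "B = rat_complex.extend_basis {a}"
  have ind: "rat_complex.independent {a}" using A by simp
  have B: "rat_complex.independent B" "rat_complex.span B = UNIV" "a \<in> B"
    using rat_complex.independent_extend_basis[OF ind] rat_complex.span_extend_basis[OF ind]
      rat_complex.extend_basis_superset[OF ind] by (auto simp: B_def)
  define f where "f z = rat_complex.representation B z a" for z
  have f_add: "f (x + y) = f x + f y" and f_scale: "f (of_rat q * x) = q * f x" for x y q
    using B by (auto simp: f_def rat_complex.representation_add rat_complex.representation_scale)
  have f_a: "f a = 1" using rat_complex.representation_basis[OF B(1,3)] by (simp add: f_def)
  have "finite ((\<lambda>(l, x). f (w ^ l * x)) ` ({..<p} \<times> A))" using A by auto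
  from finite_rat_common_denominator[OF this] obtain d :: int where "d > 0"
    and "\<forall>q\<in>(\<lambda>(l, x). f (w ^ l * x)) ` ({..<p} \<times> A). of_int d * q \<in> \<int>" by blast
  then have d: "d > 0" "\<And>l x. l < p \<Longrightarrow> x \<in> A \<Longrightarrow> of_int d * f (w ^ l * x) \<in> \<int>"
    by auto
  have integral: "of_int d * f (w ^ l * x) \<in> \<int>" if "x \<in> ?M" for x l
    using that
  proof (induction arbitrary: l rule: cyclo_span.induct)
    case zero
    show ?case using f_scale[of 0 0] by simp
  next
    case (gen x)
    have "w ^ l = w ^ (p * (l div p) + l mod p)" by simp
    also have "\<dots> = w ^ (l mod p)" unfolding power_add power_mult w by simp
    finally show ?case using d(2)[OF _ gen] p prime_gt_0_nat by simp
  next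
    case (add x y)
    then show ?case using Ints_add by (fastforce simp: f_add algebra_simps)
  next
    case (uminus x)
    then show ?case using f_scale[of "-1" "w ^ l * x"] by (simp add: of_rat_minus)
  next
    case (root x)
    then show ?case using root.IH[of "Suc l"] by (simp add: algebra_simps)
  qed
  \<comment> \<open>One exponent that is too large for \<open>d\<close> suffices: \<open>p ^ d > d\<close>.\<close>
  have "int p ^ nat d dvd d"
  proof -
    obtain y where y: "y \<in> ?M" "a = of_nat p ^ nat d * y"
      using div_p[OF cyclo_span.gen[OF A(2)]] by blast
    obtain m where m: "of_int d * f y = of_int m"
      using integral[OF y(1), of 0] by (auto elim: Ints_cases)
    have "1 = of_nat p ^ nat d * f y"
      using f_scale[of "of_nat p ^ nat d" y] f_a y(2) by (simp add: of_rat_power)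
    then have "of_int d = of_nat p ^ nat d * (of_int d * f y)" by (simp add: algebra_simps)
    also have "\<dots> = of_int (int p ^ nat d * m)" by (simp add: m)
    finally have "d = int p ^ nat d * m" unfolding of_int_eq_iff .
    then show ?thesis by (rule dvdI)
  qed
  then have "int p ^ nat d \<le> d" using d(1) zdvd_imp_le by blast
  moreover have "d < int p ^ nat d"
  proof -
    have "nat d < 2 ^ nat d" by (rule less_exp)
    also have "(2::nat) ^ nat d \<le> p ^ nat d" using p prime_ge_2_nat by (intro power_mono) auto
    finally have "int (nat d) < int (p ^ nat d)" by (simp only: of_nat_less_iff)
    then show ?thesis using d(1) by simp
  qed
  ultimately show False by simp
qed

definition coeffs_in :: "complex set \<Rightarrow> complex poly \<Rightarrow> bool" where
  "coeffs_in M g \<longleftrightarrow> (\<forall>i. coeff g i \<in> M)"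

context
  fixes w :: complex and A :: "complex set"
begin

abbreviation (input) integral_poly :: "complex poly \<Rightarrow> bool" where
  "integral_poly \<equiv> coeffs_in (cyclo_span w A)"

lemma integral_poly_add: "integral_poly g \<Longrightarrow> integral_poly h \<Longrightarrow> integral_poly (g + h)"
  by (auto simp: coeffs_in_def intro: cyclo_span.add)

lemma integral_poly_smult: "s \<in> cyclo_ring w \<Longrightarrow> integral_poly g \<Longrightarrow> integral_poly (smult s g)"
  by (auto simp: coeffs_in_def intro: cyclo_ring_mult)

lemma integral_poly_0: "integral_poly 0"
  by (auto simp: coeffs_in_def intro: cyclo_span.zero)

lemma integral_poly_shift: "integral_poly g \<Longrightarrow> integral_poly (pCons 0 g)"
  by (auto simp: coeffs_in_def coeff_pCons intro: cyclo_span.zero split: nat.split)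

lemma integral_poly_pderiv: "integral_poly g \<Longrightarrow> integral_poly (pderiv g)"
  unfolding coeffs_in_def coeff_pderiv by (blast intro: cyclo_span_of_nat)

lemma integral_poly_linear_mult:
  "s \<in> cyclo_ring w \<Longrightarrow> integral_poly g \<Longrightarrow> integral_poly ([:- s, 1:] * g)"
  using cyclo_span.uminus[of s w "{1}"]
  by (simp add: integral_poly_add integral_poly_shift integral_poly_smult del: smult_minus_left)

text \<open>
  Division by a monic linear polynomial needs no denominators: the coefficients of the quotient are
  found from the top one downwards.
\<close>

lemma integral_poly_linear_quotient:
  assumes c: "c \<in> cyclo_ring w" and g: "integral_poly ([:- c, 1:] * h)"
  shows "integral_poly h"
proof -
  have "degree h < n + d \<Longrightarrow> coeff h n \<in> cyclo_span w A" for n d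
  proof (induction d arbitrary: n)
    case 0
    then show ?case by (simp add: coeff_eq_0 cyclo_span.zero)
  next
    case (Suc d)
    have "coeff h n = coeff ([:- c, 1:] * h) (Suc n) + c * coeff h (Suc n)" by simp
    then show ?case
      using Suc g c by (metis add_Suc_shift coeffs_in_def cyclo_ring_mult cyclo_span.add)
  qed
  from this[of _ "Suc (degree h)"] show ?thesis by (simp add: coeffs_in_def)
qed

lemma integral_poly_roots_quotient:
  assumes "finite I" "C ` I \<subseteq> cyclo_ring w" "integral_poly ((\<Prod>k\<in>I. [:- C k, 1:]) * h)"
  shows "integral_poly h"
  using assms
proof (induction I rule: finite_induct)
  case (insert k I)
  then show ?case
    using integral_poly_linear_quotient[of "C k" "(\<Prod>k\<in>I. [:- C k, 1:]) * h"]
    by (simp add: mult.assoc del: mult_pCons_left)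
qed auto

text \<open>
  Vanishing to order \<open>m\<close> at \<open>1\<close> modulo \<open>1 - w\<close>, for polynomials with coefficients
  in the module \<open>M\<close> generated by \<open>A\<close>.  If \<open>w\<close> is a nontrivial \<open>p\<close>-th root of unity
  for a prime \<open>p\<close>, then \<open>M / (1 - w) M\<close> is a vector space over the field with \<open>p\<close> elements on which \<open>w\<close> acts as \<open>1\<close>.
\<close>

definition vanishing_mod :: "nat \<Rightarrow> complex poly \<Rightarrow> bool" where
  "vanishing_mod m g \<longleftrightarrow> (\<exists>h r. integral_poly h \<and> integral_poly r \<and>
     g = [:- 1, 1:] ^ m * h + smult (1 - w) r)"

text \<open>
  All powers of \<open>w\<close> are congruent to \<open>1\<close> modulo \<open>1 - w\<close>.
\<close>

lemma vanishing_mod_root_power: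
  assumes "vanishing_mod m g"
  shows "vanishing_mod (Suc m) ([:- (w ^ k), 1:] * g)"
proof -
  from assms obtain h r where hr: "integral_poly h" "integral_poly r"
     "g = [:- 1, 1:] ^ m * h + smult (1 - w) r" unfolding vanishing_mod_def by blast
  obtain s where s: "s \<in> cyclo_ring w" "1 - w ^ k = (1 - w) * s"
    using cyclo_ring_one_minus_power by blast
  have lin: "[:- (w ^ k), 1:] = [:- 1, 1:] + smult (1 - w) [:s:]" using s(2) by (simp flip: s(2))
  have one: "1 \<in> cyclo_ring w" by (rule cyclo_span.gen) simp
  have pow: "integral_poly ([:- 1, 1:] ^ n * h)" for n
    by (induction n) (use hr(1) integral_poly_linear_mult[OF one] in \<open>auto simp: mult.assoc simp del: mult_pCons_left\<close>)
  have "integral_poly (smult s ([:- 1, 1:] ^ m * h) + [:- (w ^ k), 1:] * r)"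
    using hr s pow by (intro integral_poly_add integral_poly_smult integral_poly_linear_mult cyclo_ring_power)
  moreover have "[:- (w ^ k), 1:] * g = [:- 1, 1:] ^ Suc m * h
      + smult (1 - w) (smult s ([:- 1, 1:] ^ m * h) + [:- (w ^ k), 1:] * r)"
  proof -
    have "[:- (w ^ k), 1:] * g = [:- (w ^ k), 1:] * ([:- 1, 1:] ^ m * h) 
          + smult (1 - w) ([:- (w ^ k), 1:] * r)"
      unfolding hr(3) by (simp add: distrib_left del: mult_pCons_left)
    also have "[:- (w ^ k), 1:] * ([:- 1, 1:] ^ m * h) = [:- 1, 1:] ^ Suc m * h
          + smult (1 - w) (smult s ([:- 1, 1:] ^ m * h))"
    proof -
      have "[:s:] * q = smult s q" for q by simp
      then show ?thesis
        by (simp only: lin distrib_right mult_smult_left power_Suc mult.assoc)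
    qed
    finally show ?thesis by (simp add: smult_add_right add.assoc del: mult_pCons_left)
  qed
  ultimately show ?thesis using hr(1) unfolding vanishing_mod_def by blast
qed

lemma vanishing_mod_prod:
  assumes "finite I" "integral_poly h"
  shows "vanishing_mod (card I) ((\<Prod>k\<in>I. [:- (w ^ k), 1:]) * h)"
  using assms(1)
proof (induction I rule: finite_induct)
  case empty
  then show ?case unfolding vanishing_mod_def
    using assms(2) integral_poly_0 by (intro exI[of _ h] exI[of _ 0]) auto
next
  case (insert k I)
  then show ?case using vanishing_mod_root_power[OF insert.IH, of k]
    by (simp add: mult.assoc del: mult_pCons_left)
qed

text \<open>
  The Euler operator \<open>X d/dX - c\<close> lowers an order of vanishing by at most one, and it multiplies
  the \<open>i\<close>-th coefficient by \<open>i - c\<close>.  It can thus remove chosen coefficients one after another.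
\<close>

lemma vanishing_mod_euler:
  assumes "vanishing_mod (Suc m) g"
  shows "vanishing_mod m (pCons 0 (pderiv g) - smult (of_nat c) g)"
proof -
  let ?X = "[:- 1, 1:] :: complex poly"
  from assms obtain h r where hr: "integral_poly h" "integral_poly r"
     "g = ?X ^ Suc m * h + smult (1 - w) r" unfolding vanishing_mod_def by blast
  define E where "E q = pCons 0 (pderiv q) + smult (of_int (- int c)) q" for q :: "complex poly"
  have E: "integral_poly q \<Longrightarrow> integral_poly (E q)" for q
    unfolding E_def
    by (intro integral_poly_add integral_poly_shift integral_poly_pderiv integral_poly_smult cyclo_ring_of_int)
  \<comment> \<open>Leibniz rule for \<open>(X - 1) ^ (m + 1) * h\<close>, with one factor \<open>(X - 1) ^ m\<close> taken out.\<close>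
  define h' where "h' = smult (of_int (int (Suc m))) (pCons 0 h) + ?X * E h"
  have "integral_poly h'"
    unfolding h'_def using hr(1) E[OF hr(1)] cyclo_ring_of_int[of 1 w]
    by (intro integral_poly_add integral_poly_shift integral_poly_smult cyclo_ring_of_int
        integral_poly_linear_mult) auto
  moreover have "pCons 0 (pderiv g) - smult (of_nat c) g = ?X ^ m * h' + smult (1 - w) (E r)"
  proof -
    have dX: "pderiv (?X ^ Suc m) = smult (of_nat (Suc m)) (?X ^ m)"
      by (simp add: pderiv_power_Suc pderiv_pCons del: power_Suc)
    have "pderiv g = ?X ^ Suc m * pderiv h + h * smult (of_nat (Suc m)) (?X ^ m) + smult (1 - w) (pderiv r)"
      unfolding hr(3) pderiv_add pderiv_mult dX pderiv_smult ..
    then have dg: "poly (pderiv g) x = poly ?X x ^ Suc m * poly (pderiv h) x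
        + poly h x * (of_nat (Suc m) * poly ?X x ^ m) + (1 - w) * poly (pderiv r) x" for x
      by (simp only: poly_add poly_mult poly_smult poly_power)
    have gx: "poly g x = poly ?X x ^ Suc m * poly h x + (1 - w) * poly r x" for x
      unfolding hr(3) by (simp only: poly_add poly_mult poly_smult poly_power)
    have Ex: "poly (E q) x = x * poly (pderiv q) x - of_nat c * poly q x" for q x
      by (simp add: E_def)
    have hx: "poly h' x = of_nat (Suc m) * (x * poly h x) + poly ?X x * poly (E h) x" for x
      by (simp only: h'_def poly_add poly_mult poly_smult poly_pCons of_int_of_nat_eq add_0)
    have "poly (pCons 0 (pderiv g) - smult (of_nat c) g) x
        = poly (?X ^ m * h' + smult (1 - w) (E r)) x" for x
      by (simp only: poly_diff poly_pCons[of 0] poly_add poly_mult poly_smult poly_power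
            dg gx hx Ex power_Suc add_0) algebra
    then show ?thesis by (intro poly_eq_poly_eq_iff[THEN iffD1] ext)
  qed
  ultimately show ?thesis unfolding vanishing_mod_def using E[OF hr(2)] by blast
qed

lemma vanishing_mod_scale_coeffs:
  assumes "finite K" "vanishing_mod (m + card K) g"
  shows "\<exists>g'. vanishing_mod m g' \<and> (\<forall>i. coeff g' i = (\<Prod>c\<in>K. of_nat i - of_nat c) * coeff g i)"
  using assms
proof (induction K arbitrary: g rule: finite_induct)
  case empty
  then show ?case by auto
next
  case (insert c K)
  let ?g = "pCons 0 (pderiv g) - smult (of_nat c) g"
  have "vanishing_mod (m + card K) ?g"
    using insert by (intro vanishing_mod_euler) simp
  from insert.IH[OF this] obtain g' where g': "vanishing_mod m g'"
    "\<forall>i. coeff g' i = (\<Prod>c\<in>K. of_nat i - of_nat c) * coeff ?g i" by blast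
  have "coeff ?g i = (of_nat i - of_nat c) * coeff g i" for i
    by (cases i) (auto simp: coeff_pderiv algebra_simps)
  with g' show ?case using insert.hyps by (intro exI[of _ g']) (auto simp: algebra_simps)
qed

end

lemma prime_root_of_unity_inj:
  fixes w :: complex
  assumes p: "prime p" and w: "w ^ p = 1" "w \<noteq> 1"
  shows "inj_on (\<lambda>k. w ^ k) {..<p}"
proof -
  have *: False if "k < l" "l < p" "w ^ k = w ^ l" for k l
  proof -
    have w0: "w \<noteq> 0" using w(1) p by (metis power_eq_0_iff prime_gt_0_nat zero_neq_one zero_power)
    define d where "d = l - k"
    have d: "0 < d" "d < p" using that by (auto simp: d_def)
    have "w ^ l = w ^ k * w ^ d" using that(1) by (simp add: d_def flip: power_add)
    then have wd: "w ^ d = 1" using that w0 by simp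
    have "coprime d p"
      using p d by (metis coprime_commute dvd_imp_le leD prime_imp_coprime)
    then obtain x y where xy: "d * x = p * y + 1"
      using bezout_nat[of d p] d by (metis coprime_imp_gcd_eq_1 not_less_zero)
    have "w ^ (d * x) = 1" by (simp add: power_mult wd)
    moreover have "w ^ (d * x) = w" unfolding xy power_add power_mult w by simp
    ultimately show False using w by simp
  qed
  show ?thesis
    by (rule linorder_inj_onI') (use * in auto)
qed

definition dft :: "nat \<Rightarrow> complex \<Rightarrow> (nat \<Rightarrow> complex) \<Rightarrow> nat \<Rightarrow> complex" where
  "dft p w a k = (\<Sum>j<p. a j * w ^ (j * k))"

text \<open>
  Chebotarev's theorem on minors of the Fourier matrix, in the form: a polynomial of degree below
  \<open>p\<close> vanishes at fewer \<open>p\<close>-th roots of unity than it has terms.  Suppose it vanishes at least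
  at as many, and let \<open>M\<close> be generated by its coefficients.  Modulo \<open>1 - w\<close> all the roots
  become \<open>1\<close>, so the polynomial vanishes there to order at least \<open>card J\<close>.  Removing all
  terms but the \<open>j\<close>-th by \<open>card J - 1\<close> Euler operators leaves a monomial whose value at \<open>1\<close>
  is still \<open>0\<close> modulo \<open>1 - w\<close>.  Its coefficient is \<open>a j\<close> times an integer prime to \<open>p\<close>, so
  \<open>a j\<close> is divisible by \<open>1 - w\<close>.  This holds for every generator of \<open>M\<close>, which is impossible.
\<close>

lemma sparse_poly_few_roots:
  fixes a :: "nat \<Rightarrow> complex"
  assumes p: "prime p" and w: "w ^ p = 1" "w \<noteq> 1"
    and J: "J = {j\<in>{..<p}. a j \<noteq> 0}" "J \<noteq> {}"
    and I: "I = {k\<in>{..<p}. dft p w a k = 0}"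
  shows "card I < card J"
proof (rule ccontr)
  assume "\<not> card I < card J"
  then have le: "card J \<le> card I" by simp
  define g where "g = (\<Sum>j<p. monom (a j) j)"
  let ?A = "a ` J"
  let ?M = "cyclo_span w ?A"
  have coeff_g: "coeff g i = (if i < p then a i else 0)" for i
    by (simp add: g_def coeff_sum)
  have fin: "finite I" "finite J" using I J by auto
  have int_g: "coeffs_in ?M g"
    unfolding coeffs_in_def coeff_g using J(1)
    by (metis (mono_tags, lifting) CollectI cyclo_span.gen cyclo_span.zero image_eqI lessThan_iff)
  have root: "poly g (w ^ k) = 0" if "k \<in> I" for k
    using that by (simp add: I dft_def g_def poly_sum poly_monom mult.commute flip: power_mult)
  have "(\<Prod>k\<in>I'. [:- (w ^ k), 1:]) dvd g" if "I' \<subseteq> I" "finite I'" for I'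
    using that(2,1)
  proof (induction I' rule: finite_induct)
    case (insert k I')
    then obtain h where h: "g = (\<Prod>k\<in>I'. [:- (w ^ k), 1:]) * h" by auto
    have "poly (\<Prod>k\<in>I'. [:- (w ^ k), 1:]) (w ^ k) \<noteq> 0"
      using insert prime_root_of_unity_inj[OF p w] I
      by (auto simp: poly_prod inj_on_def)
    then have "poly h (w ^ k) = 0" using root[of k] insert.prems h by auto
    then obtain h' where "h = [:- (w ^ k), 1:] * h'" by (auto simp: poly_eq_0_iff_dvd)
    then have "g = (\<Prod>k\<in>insert k I'. [:- (w ^ k), 1:]) * h'"
      unfolding prod.insert[OF insert.hyps(1,2)] by (simp only: h mult_ac)
    then show ?case by (rule dvdI)
  qed auto
  then obtain h where h: "g = (\<Prod>k\<in>I. [:- (w ^ k), 1:]) * h" using fin by blast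
  have "coeffs_in ?M h"
    using int_g unfolding h
    by (rule integral_poly_roots_quotient[OF fin(1), rotated]) (auto intro: cyclo_ring_power)
  then have van: "vanishing_mod w ?A (card I) g"
    unfolding h by (rule vanishing_mod_prod[OF fin(1)])
  have "\<exists>y\<in>?M. a j = (1 - w) * y" if j: "j \<in> J" for j
  proof -
    let ?K = "J - {j}"
    have "card I = (card I - card ?K) + card ?K" using le j fin by (simp add: card_Diff_singleton)
    then obtain g' where g': "vanishing_mod w ?A (card I - card ?K) g'"
      "\<And>i. coeff g' i = (\<Prod>c\<in>?K. of_nat i - of_nat c) * coeff g i"
      using vanishing_mod_scale_coeffs[of ?K w ?A "card I - card ?K" g] van fin by auto
    define C where "C = (\<Prod>c\<in>?K. int j - int c)"
    have "coeff g' i = coeff (monom (of_int C * a j) j) i" for i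
    proof (cases "i = j")
      case True
      then show ?thesis using j J by (simp add: g' coeff_g C_def)
    next
      case False
      then show ?thesis using fin J(1) by (auto simp: g' coeff_g)
    qed
    then have g'_eq: "g' = monom (of_int C * a j) j" by (rule poly_eqI)
    have pos: "card I - card ?K > 0"
      using le j fin card_gt_0_iff[of J] by (auto simp: card_Diff_singleton)
    from g'(1) obtain h r where hr: "coeffs_in ?M r"
        "g' = [:- 1, 1:] ^ (card I - card ?K) * h + smult (1 - w) r"
      unfolding vanishing_mod_def by blast
    have "of_int C * a j = poly g' 1" by (simp add: g'_eq poly_monom)
    also have "\<dots> = (1 - w) * poly r 1" using pos by (simp add: hr(2))
    finally have C1: "of_int C * a j = (1 - w) * poly r 1" .
    have r1: "poly r 1 \<in> ?M" using hr(1) by (auto simp: poly_altdef coeffs_in_def intro: cyclo_span_sum)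
    have "\<not> int p dvd C"
    proof
      assume "int p dvd C"
      then obtain c where c: "c \<in> ?K" "int p dvd int j - int c"
        unfolding C_def using p fin by (subst (asm) prime_dvd_prod_iff) auto
      \<comment> \<open>Distinct exponents below \<open>p\<close> stay distinct modulo \<open>p\<close>.\<close>
      have "\<bar>int j - int c\<bar> < int p" "int j - int c \<noteq> 0" using c(1) j J(1) by auto
      then show False using c(2) by (metis dvd_abs_iff zdvd_not_zless zero_less_abs_iff)
    qed
    then have "coprime (int p) C" using p by (intro prime_imp_coprime) auto
    then obtain u v where uv: "u * int p + v * C = 1"
      using bezout_int[of "int p" C] by (metis coprime_imp_gcd_eq_1)
    obtain s where s: "s \<in> cyclo_ring w" "of_nat p = (1 - w) * s"
      using cyclo_ring_prime_ramifies(1)[OF p w] by blast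
    have aj: "a j \<in> ?M" using j by (auto intro: cyclo_span.gen)
    \<comment> \<open>Both \<open>p * a j\<close> and \<open>C * a j\<close> lie in \<open>(1 - w) M\<close>, and \<open>p\<close>, \<open>C\<close> are coprime.\<close>
    have "a j = of_int (u * int p + v * C) * a j" by (simp add: uv)
    also have "\<dots> = of_int u * (of_nat p * a j) + of_int v * (of_int C * a j)"
      by (simp add: algebra_simps)
    also have "\<dots> = (1 - w) * (of_int u * (s * a j) + of_int v * poly r 1)"
      unfolding C1 s(2) by (simp add: algebra_simps)
    finally show ?thesis
      using s(1) aj r1
      by (blast intro: cyclo_span.add cyclo_span_of_int cyclo_ring_mult)
  qed
  moreover obtain j where "j \<in> J" using J(2) by blast
  ultimately show False
    using cyclo_span_not_divisible[OF p w, of ?A "a j"] fin J(1) by fast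
qed

theorem uncertainty_principle_prime:
  fixes a :: "nat \<Rightarrow> complex"
  assumes p: "prime p" and w: "w ^ p = 1" "w \<noteq> 1" and a: "\<exists>j<p. a j \<noteq> 0"
  shows "p < card {j\<in>{..<p}. a j \<noteq> 0} + card {k\<in>{..<p}. dft p w a k \<noteq> 0}"
proof -
  let ?F = "dft p w a"
  have "card {k\<in>{..<p}. ?F k = 0} < card {j\<in>{..<p}. a j \<noteq> 0}"
    by (rule sparse_poly_few_roots[OF p w refl _ refl]) (use a in auto)
  moreover have "card {k\<in>{..<p}. ?F k = 0} + card {k\<in>{..<p}. ?F k \<noteq> 0} = card {..<p}"
    by (subst card_Un_disjoint[symmetric]) (auto intro!: arg_cong[where f = card] simp del: card_lessThan)
  ultimately show ?thesis by simp
qed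


section \<open>Bounding and counting the cyclic roots\<close>

definition supnorm_sphere :: "nat \<Rightarrow> (nat \<Rightarrow> complex) set" where
  "supnorm_sphere p =
     {u. (\<forall>i<p. cmod (u i) \<le> 1) \<and> (\<forall>i\<ge>p. u i = 0) \<and> (\<exists>i<p. cmod (u i) = 1)}"

lemma compact_supnorm_sphere: "compact (supnorm_sphere p)"
proof -
  let ?B = "PiE UNIV (\<lambda>i. if i < p then cball 0 1 else {0 :: complex})"
  have "compactin (product_topology (\<lambda>_. euclidean) UNIV) ?B"
    unfolding compactin_PiE by auto
  then have "compact ?B"
    by (simp add: euclidean_product_topology)
  moreover have "closed (\<Union>i<p. {u :: nat \<Rightarrow> complex. cmod (u i) = 1})"
    by (intro closed_UN ballI closed_Collect_eq continuous_on_norm continuous_on_product_coordinates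
              continuous_on_const) auto
  ultimately have "compact (?B \<inter> (\<Union>i<p. {u :: nat \<Rightarrow> complex. cmod (u i) = 1}))"
    by (rule compact_Int_closed)
  also have "?B \<inter> (\<Union>i<p. {u :: nat \<Rightarrow> complex. cmod (u i) = 1}) = supnorm_sphere p"
  proof -
    have "u \<in> ?B \<longleftrightarrow> (\<forall>i. (i < p \<longrightarrow> cmod (u i) \<le> 1) \<and> (\<not> i < p \<longrightarrow> u i = 0))" for u
      unfolding PiE_UNIV_domain Pi_iff by (simp add: if_distrib[where f = "\<lambda>S. _ \<in> S"] if_bool_eq_conj)
    then show ?thesis unfolding supnorm_sphere_def not_less by blast
  qed
  finally show ?thesis .
qed

text \<open>
  The overlap vanishes exactly when \<open>u\<close> and \<open>v\<close> have disjoint supports and so do their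
  transforms.  The inverse root of unity in the second transform makes the products
  \<open>dft p w u k * dft p (inverse w) v k\<close> the transform of the correlation of \<open>u\<close> and
  \<open>v\<close>.
\<close>

definition overlap :: "nat \<Rightarrow> complex \<Rightarrow> (nat \<Rightarrow> complex) \<Rightarrow> (nat \<Rightarrow> complex) \<Rightarrow> real" where
  "overlap p w u v =
     (\<Sum>i<p. cmod (u i * v i)) + (\<Sum>k<p. cmod (dft p w u k * dft p (inverse w) v k))"

text \<open>
  If the overlap were zero, the supports would have at most \<open>p\<close> elements in total, and likewise
  the supports of the transforms.  By the uncertainty principle the four together have more than
  \<open>2 * p\<close>.
\<close>

lemma overlap_pos:
  assumes p: "prime p" and w: "w ^ p = 1" "w \<noteq> 1"
    and u: "\<exists>j<p. u j \<noteq> 0" and v: "\<exists>j<p. v j \<noteq> 0"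
  shows "overlap p w u v > 0"
proof (rule ccontr)
  assume "\<not> overlap p w u v > 0"
  moreover have "(\<Sum>i<p. cmod (u i * v i)) \<ge> 0"
      "(\<Sum>k<p. cmod (dft p w u k * dft p (inverse w) v k)) \<ge> 0"
    by (auto intro: sum_nonneg)
  ultimately have "(\<Sum>i<p. cmod (u i * v i)) = 0"
      "(\<Sum>k<p. cmod (dft p w u k * dft p (inverse w) v k)) = 0"
    unfolding overlap_def by linarith+
  then have zero: "\<And>i. i < p \<Longrightarrow> u i = 0 \<or> v i = 0"
      "\<And>k. k < p \<Longrightarrow> dft p w u k = 0 \<or> dft p (inverse w) v k = 0"
    by (auto simp: sum_nonneg_eq_0_iff)
  have disj: "card {i\<in>{..<p}. P i} + card {i\<in>{..<p}. Q i} \<le> p"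
    if "\<And>i. i < p \<Longrightarrow> \<not> P i \<or> \<not> Q i" for P Q
  proof -
    have "card {i\<in>{..<p}. P i} + card {i\<in>{..<p}. Q i} = card ({i\<in>{..<p}. P i} \<union> {i\<in>{..<p}. Q i})"
      by (rule card_Un_disjoint[symmetric]) (use that in auto)
    also have "\<dots> \<le> card {..<p}" by (rule card_mono) auto
    finally show ?thesis by simp
  qed
  have "inverse w ^ p = 1" "inverse w \<noteq> 1" using w by (simp_all add: power_inverse)
  then show False
    using uncertainty_principle_prime[OF p w u] uncertainty_principle_prime[OF p _ _ v, of "inverse w"]
      disj[of "\<lambda>i. u i \<noteq> 0" "\<lambda>i. v i \<noteq> 0"]
      disj[of "\<lambda>k. dft p w u k \<noteq> 0" "\<lambda>k. dft p (inverse w) v k \<noteq> 0"] zero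
    by fastforce
qed

lemma overlap_scale:
  "overlap p w (\<lambda>i. of_real a * u i) (\<lambda>i. of_real b * v i) = \<bar>a\<bar> * \<bar>b\<bar> * overlap p w u v"
proof -
  have "dft p w' (\<lambda>i. c * f i) k = c * dft p w' f k" for w' c f k
    by (simp add: dft_def sum_distrib_left mult.assoc)
  then show ?thesis
    unfolding overlap_def
    by (simp add: norm_mult sum_distrib_left distrib_left mult_ac)
qed

text \<open>
  Positivity is made quantitative by compactness: \<open>e\<close> is the minimum of the overlap over pairs of
  vectors of supremum norm \<open>1\<close>, and homogeneity extends the bound to all vectors.
\<close>

lemma overlap_lower_bound:
  assumes p: "prime p" and w: "w ^ p = 1" "w \<noteq> 1"
  obtains e where "e > 0"
    "\<And>u v i j. i < p \<Longrightarrow> j < p \<Longrightarrow> e * (cmod (u i) * cmod (v j)) \<le> overlap p w u v"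
proof -
  let ?K = "supnorm_sphere p"
  have p0: "p > 0" using p prime_gt_0_nat by blast
  have c1: "continuous_on (?K \<times> ?K) (\<lambda>x. fst x i)" for i
    by (rule continuous_on_product_then_coordinatewise[OF continuous_on_fst[OF continuous_on_id]])
  have c2: "continuous_on (?K \<times> ?K) (\<lambda>x. snd x i)" for i
    by (rule continuous_on_product_then_coordinatewise[OF continuous_on_snd[OF continuous_on_id]])
  have "(\<lambda>i. if i < p then 1 else 0) \<in> ?K" using p0 by (auto simp: supnorm_sphere_def)
  then have "?K \<times> ?K \<noteq> {}" by blast
  have "compact (?K \<times> ?K)" by (intro compact_Times compact_supnorm_sphere)
  moreover note \<open>?K \<times> ?K \<noteq> {}\<close>
  moreover have "continuous_on (?K \<times> ?K) (\<lambda>x. overlap p w (fst x) (snd x))"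
    unfolding overlap_def dft_def by (intro continuous_intros c1 c2)
  ultimately have "\<exists>x\<in>?K \<times> ?K. \<forall>y\<in>?K \<times> ?K.
      overlap p w (fst x) (snd x) \<le> overlap p w (fst y) (snd y)"
    by (rule continuous_attains_inf)
  then obtain x where x: "x \<in> ?K \<times> ?K"
    "\<And>y. y \<in> ?K \<times> ?K \<Longrightarrow> overlap p w (fst x) (snd x) \<le> overlap p w (fst y) (snd y)"
    by blast
  define e where "e = overlap p w (fst x) (snd x)"
  have nz: "\<exists>i<p. u i \<noteq> 0" if "u \<in> ?K" for u
    using that by (force simp: supnorm_sphere_def)
  have "e > 0" unfolding e_def by (rule overlap_pos[OF p w]) (use x(1) nz in auto)
  moreover have "e * (cmod (u i) * cmod (v j)) \<le> overlap p w u v" if ij: "i < p" "j < p" for u v i j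
  proof (cases "u i = 0 \<or> v j = 0")
    case True
    then show ?thesis by (auto simp: overlap_def intro!: add_nonneg_nonneg sum_nonneg)
  next
    case False
    have normalise: "\<exists>a \<ge> cmod (f i). (\<lambda>k. of_real (1 / a) * (if k < p then f k else 0)) \<in> ?K"
      if "i < p" "f i \<noteq> 0" for f :: "nat \<Rightarrow> complex" and i
    proof -
      define a where "a = Max ((\<lambda>k. cmod (f k)) ` {..<p})"
      have ge: "cmod (f k) \<le> a" if "k < p" for k
        unfolding a_def using that by (intro Max_ge) auto
      have "a \<in> (\<lambda>k. cmod (f k)) ` {..<p}" unfolding a_def using p0 by (intro Max_in) auto
      then obtain m where m: "m < p" "a = cmod (f m)" by auto
      have "a > 0" using ge[OF \<open>i < p\<close>] \<open>f i \<noteq> 0\<close> by (smt (verit) zero_less_norm_iff)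
      then show ?thesis
        using ge m \<open>i < p\<close>
        by (intro exI[of _ a]) (auto simp: supnorm_sphere_def norm_mult norm_divide intro!: exI[of _ m])
    qed
    let ?cut = "\<lambda>f k. if k < p then f k else (0::complex)"
    obtain a where a: "a \<ge> cmod (u i)" "(\<lambda>k. of_real (1 / a) * ?cut u k) \<in> ?K"
      using normalise[of i u] False ij by blast
    obtain b where b: "b \<ge> cmod (v j)" "(\<lambda>k. of_real (1 / b) * ?cut v k) \<in> ?K"
      using normalise[of j v] False ij by blast
    have pos: "a > 0" "b > 0" using a(1) b(1) False by (smt (verit) zero_less_norm_iff)+
    have cut: "overlap p w (?cut u) (?cut v) = overlap p w u v"
      by (simp add: overlap_def dft_def)
    have "e \<le> overlap p w (\<lambda>k. of_real (1 / a) * ?cut u k) (\<lambda>k. of_real (1 / b) * ?cut v k)"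
      using x(2)[of "(_, _)"] a(2) b(2) unfolding e_def by fastforce
    also have "\<dots> = overlap p w u v / (a * b)"
      unfolding overlap_scale cut using pos by simp
    finally have "e * (a * b) \<le> overlap p w u v" using pos by (simp add: pos_le_divide_eq)
    moreover have "e * (cmod (u i) * cmod (v j)) \<le> e * (a * b)"
      using \<open>e > 0\<close> a(1) b(1) pos by (intro mult_left_mono mult_mono) auto
    ultimately show ?thesis by linarith
  qed
  ultimately show thesis by (rule that)
qed

text \<open>
  The numbers \<open>x\<^sub>m = z\<^sub>0 \<dots> z\<^sub>m\<^sub>-\<^sub>1\<close>.  All \<open>m\<close> are allowed, with
  the indices of \<open>z\<close> taken modulo \<open>n\<close>, so that cyclic shifts need no case distinction: on a
  cyclic root the sequence is periodic.
\<close>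

definition partial_product :: "nat \<Rightarrow> (nat \<Rightarrow> complex) \<Rightarrow> nat \<Rightarrow> complex" where
  "partial_product n z m = (\<Prod>k<m. z (k mod n))"

lemma sum_periodic_shift:
  fixes f :: "nat \<Rightarrow> 'a::ab_group_add"
  assumes "\<And>m. f (m + n) = f m"
  shows "(\<Sum>j<n. f (i + j)) = (\<Sum>j<n. f j)"
proof (induction i)
  case (Suc i)
  have "(\<Sum>j<n. f (Suc i + j)) = (\<Sum>j<n. f (i + Suc j))" by simp
  also have "\<dots> = (\<Sum>j<Suc n. f (i + j)) - f i"
    unfolding sum.lessThan_Suc_shift by simp
  also have "\<dots> = (\<Sum>j<n. f (i + j))" using assms[of i] by simp
  finally show ?case using Suc by simp
qed simp

context
  fixes n :: nat and z :: "nat \<Rightarrow> complex"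
  assumes n: "n > 0" and z: "z \<in> cyclic_roots n"
begin

lemma cyclic_root_nonzero: "i < n \<Longrightarrow> z i \<noteq> 0"
proof
  assume "i < n" "z i = 0"
  then have "(\<Prod>i<n. z i) = 0" by (intro prod_zero) auto
  moreover have "(\<Prod>i<n. z i) = 1" using z by (simp add: cyclic_roots_def)
  ultimately show False by (metis zero_neq_one)
qed

lemma partial_product_nonzero: "partial_product n z m \<noteq> 0"
  using cyclic_root_nonzero n by (auto simp: partial_product_def)

lemma partial_product_add:
  "partial_product n z (i + j) = partial_product n z i * (\<Prod>k<j. z ((i + k) mod n))"
  by (induction j) (auto simp: partial_product_def)

lemma partial_product_periodic: "partial_product n z (m + n) = partial_product n z m"
proof -
  have "partial_product n z n = (\<Prod>i<n. z i)"
    unfolding partial_product_def by (rule prod.cong) auto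
  then show ?thesis
    using z partial_product_add[of n m]
    by (simp add: cyclic_roots_def add.commute partial_product_def)
qed

text \<open>
  Here the defining equations of a cyclic root become linear conditions: each product of consecutive
  entries is a quotient of two partial products.
\<close>

lemma partial_product_correlation:
  assumes "j < n"
  shows "(\<Sum>i<n. partial_product n z (i + j) * inverse (partial_product n z i))
       = (if j = 0 then of_nat n else 0)"
proof (cases "j = 0")
  case False
  have "(\<Sum>i<n. partial_product n z (i + j) * inverse (partial_product n z i))
      = (\<Sum>i<n. \<Prod>k<j. z ((i + k) mod n))"
    by (simp add: partial_product_add partial_product_nonzero field_simps)
  also have "\<dots> = 0" using z False assms by (auto simp: cyclic_roots_def)
  finally show ?thesis using False by simp
qed (simp add: partial_product_nonzero)

text \<open>
  The transform of a correlation is the product of the transforms, and the transform of a multiple of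
  the unit impulse is constant.
\<close>

lemma partial_product_dft:
  assumes w: "w ^ n = 1"
  shows "dft n w (partial_product n z) k * dft n (inverse w) (\<lambda>i. inverse (partial_product n z i)) k
       = of_nat n"
proof -
  let ?x = "partial_product n z"
  have w0: "w \<noteq> 0" using w n by (auto simp: power_0_left)
  have shift: "dft n w ?x k = (\<Sum>j<n. ?x (i + j) * w ^ ((i + j) * k))" for i
  proof -
    have "w ^ ((m + n) * k) = w ^ (m * k)" for m
      by (simp add: distrib_right power_add power_mult w)
    then show ?thesis
      unfolding dft_def using partial_product_periodic by (intro sum_periodic_shift[symmetric]) simp
  qed
  have "dft n w ?x k * dft n (inverse w) (\<lambda>i. inverse (?x i)) k
     = (\<Sum>i<n. dft n w ?x k * (inverse (?x i) * inverse w ^ (i * k)))"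
    by (simp add: dft_def[of n "inverse w"] sum_distrib_left)
  also have "\<dots> = (\<Sum>i<n. \<Sum>j<n. w ^ (j * k) * (?x (i + j) * inverse (?x i)))"
  proof (intro sum.cong refl)
    fix i
    show "dft n w ?x k * (inverse (?x i) * inverse w ^ (i * k))
        = (\<Sum>j<n. w ^ (j * k) * (?x (i + j) * inverse (?x i)))"
      unfolding shift[of i] sum_distrib_right
      by (rule sum.cong) (auto simp: distrib_right power_add power_inverse w0 field_simps)
  qed
  also have "\<dots> = (\<Sum>j<n. w ^ (j * k) * (\<Sum>i<n. ?x (i + j) * inverse (?x i)))"
    by (subst sum.swap) (simp add: sum_distrib_left)
  also have "\<dots> = (\<Sum>j<n. if j = 0 then of_nat n else 0)"
    by (rule sum.cong) (auto simp: partial_product_correlation)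
  also have "\<dots> = of_nat n" using n by simp
  finally show ?thesis .
qed

lemma cyclic_root_eq_ratio:
  assumes "k < n"
  shows "\<exists>i<n. z k = partial_product n z i * inverse (partial_product n z k)"
proof -
  have "z k = partial_product n z (k + 1) * inverse (partial_product n z k)"
    using assms by (simp add: partial_product_add[of k 1] partial_product_nonzero del: One_nat_def)
  moreover have "partial_product n z (k + 1) = partial_product n z ((k + 1) mod n)"
  proof (cases "k + 1 = n")
    case True
    then show ?thesis using partial_product_periodic[of 0] by simp
  qed (use assms in simp)
  ultimately show ?thesis using n by (intro exI[of _ "(k + 1) mod n"]) auto
qed

end

text \<open>
  For \<open>x\<close> the partial products and \<open>y = 1/x\<close>, the overlap has the constant value
  \<open>p + p\<^sup>2\<close>, and every entry of \<open>z\<close> is a product of an entry of \<open>x\<close> and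
  one of \<open>y\<close>.
\<close>

lemma cyclic_roots_bounded:
  assumes p: "prime p"
  obtains R where "\<And>z k. z \<in> cyclic_roots p \<Longrightarrow> k < p \<Longrightarrow> cmod (z k) \<le> R"
proof -
  have p2: "p \<ge> 2" using p by (rule prime_ge_2_nat)
  have "\<exists>w::complex. w ^ p = 1 \<and> w \<noteq> 1"
  proof (rule ccontr)
    assume "\<not> ?thesis"
    then have "card {w::complex. w ^ p = 1} \<le> card {1::complex}" by (intro card_mono) auto
    then show False using card_roots_unity_eq[of p] p2 by simp
  qed
  then obtain w :: complex where w: "w ^ p = 1" "w \<noteq> 1" by blast
  obtain e where e: "e > 0"
    "\<And>u v i j. i < p \<Longrightarrow> j < p \<Longrightarrow> e * (cmod (u i) * cmod (v j)) \<le> overlap p w u v"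
    using overlap_lower_bound[OF p w] by blast
  show thesis
  proof (rule that)
    fix z k assume z: "z \<in> cyclic_roots p" and k: "k < p"
    have p0: "p > 0" using p2 by simp
    let ?x = "partial_product p z"
    obtain i where i: "i < p" "z k = ?x i * inverse (?x k)"
      using cyclic_root_eq_ratio[OF p0 z k] by blast
    have "e * cmod (z k) \<le> overlap p w ?x (\<lambda>i. inverse (?x i))"
      using e(2)[OF i(1) k, of ?x "\<lambda>i. inverse (?x i)"] by (simp add: i(2) norm_mult)
    also have "\<dots> = real p + real p * real p"
      by (simp add: overlap_def partial_product_nonzero[OF p0 z] partial_product_dft[OF p0 z w(1)])
    finally show "cmod (z k) \<le> (real p + real p * real p) / e"
      using e(1) by (simp add: pos_le_divide_eq mult.commute)
  qed
qed

text \<open>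
  Extensionality is algebraic as well: outside \<open>{..<n}\<close> the coordinates equal the constant
  \<open>undefined\<close>.
\<close>

lemma cyclic_roots_algebraic:
  obtains F where "F \<subseteq> polyfuns" "cyclic_roots n = {z. \<forall>f\<in>F. f z = 0}"
proof
  let ?E = "\<lambda>j z. \<Sum>i<n. \<Prod>k<j. z ((i + k) mod n) :: complex"
  let ?F = "(\<lambda>i z. z i - undefined) ` {n..} \<union> ?E ` {1..n - 1} \<union> {\<lambda>z. (\<Prod>i<n. z i) - 1}"
  show "?F \<subseteq> polyfuns"
    by (auto intro!: polyfuns_diff polyfuns_sum polyfuns_prod polyfuns.var polyfuns.const)
  show "cyclic_roots n = {z. \<forall>f\<in>?F. f z = 0}"
    by (rule set_eqI) (auto simp: cyclic_roots_def PiE_iff extensional_def ball_Un not_less)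
qed

theorem theorem3p5:
  fixes p :: nat
  assumes "prime p"
  shows "finite (cyclic_roots p)"
proof -
  let ?V = "cyclic_roots p"
  obtain F where F: "F \<subseteq> polyfuns" "?V = {z. \<forall>f\<in>F. f z = 0}"
    by (rule cyclic_roots_algebraic)
  obtain R where R: "\<And>z k. z \<in> ?V \<Longrightarrow> k < p \<Longrightarrow> cmod (z k) \<le> R"
    using cyclic_roots_bounded[OF assms] by blast
  have "finite ((\<lambda>z. z i) ` ?V)" if "i < p" for i
    by (rule bounded_coordinate_imp_finite[OF F]) (rule R[OF _ that])
  then have "finite (PiE {..<p} (\<lambda>i. (\<lambda>z. z i) ` ?V))"
    by (intro finite_PiE) auto
  moreover have "?V \<subseteq> PiE {..<p} (\<lambda>i. (\<lambda>z. z i) ` ?V)"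
    by (auto simp: cyclic_roots_def PiE_def)
  ultimately show ?thesis by (rule rev_finite_subset)
qed

end
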